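(* Let $C$ be a slant helix in the Myller configuration $M(C,\bar\xi,\pi)$, with fixed unit axis $\bar d$ and constant angle $\theta$ defined by $\langle\bar\xi_2,\bar d\rangle=\cos\theta$. Then the axis is given by $$\bar d=\mp\sin\theta\,\frac{K_2}{\sqrt{K_1^2+K_2^2}}\,\bar\xi_1+(\cos\theta)\,\bar\xi_2\mp\sin\theta\,\frac{K_1}{\sqrt{K_1^2+K_2^2}}\,\bar\xi_3,$$ where the same choice of sign is taken in both occurrences of $\mp$ (and for all $s$).
   Context: All data are smooth. Let $C$ be a curve in Euclidean space $E^3$ with arclength parameter $s\in I$ ($I$ an interval) and position vector $\bar r(s)$, let $\bar\xi(s)$ be a unit vector field along $C$ (a versor field $(C,\bar\xi)$), and let $\pi(s)$ be a plane field along $C$ with $\bar\xi(s)\in\pi(s)$. The pair $((C,\bar\xi),(C,\pi))$ is called a Myller configuration $M=M(C,\bar\xi,\pi)$. Put $\bar\xi_1=\bar\xi$, $K_1=\|d\bar\xi/ds\|>0$ (curvature), define $\bar\xi_2$ by $\bar\xi_1'=K_1\bar\xi_2$, and $\bar\xi_3=\bar\xi_1\times\bar\xi_2$. Then $R_F=\{P(s);\bar\xi_1,\bar\xi_2,\bar\xi_3\}$ is a positively oriented orthonormal frame, the Frenet-type frame, and $$\bar\xi_1'=K_1\bar\xi_2,\quad \bar\xi_2'=-K_1\bar\xi_1+K_2\bar\xi_3,\quad \bar\xi_3'=-K_2\bar\xi_2,$$ which defines the torsion $K_2$. A prime denotes $d/ds$. The curve $C$ is called a slant helix (or $\bar\xi_2$-helix)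 in $M$ if $\bar\xi_2$ makes a constant angle with a fixed unit vector $\bar d$, called the axis. *)

theory Defs
  imports "HOL-Analysis.Analysis"
begin

unbundle cross3_syntax

text \<open>
  Derivatives are taken relative to the parameter set, so at an endpoint that belongs to the
  parameter interval they are one-sided. The notion is only used on sets without isolated points,
  where vector derivatives are unique.
\<close>

definition deriv_on :: "real set \<Rightarrow> (real \<Rightarrow> 'a::real_normed_vector) \<Rightarrow> real \<Rightarrow> 'a" where
  "deriv_on I f s = vector_derivative f (at s within I)"

definition smooth_curve_on :: "real set \<Rightarrow> (real \<Rightarrow> 'a::real_normed_vector) \<Rightarrow> bool" where
  "smooth_curve_on I f \<longleftrightarrow> (\<forall>n. (deriv_on I ^^ n) f differentiable_on I)"

text \<open>
  A plane field assigns to each parameter the direction of the plane through the corresponding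
  point of the curve, i.e. a two-dimensional linear subspace. Smoothness means that it locally
  has a smooth frame.
\<close>

definition smooth_plane_field_on :: "real set \<Rightarrow> (real \<Rightarrow> (real^3) set) \<Rightarrow> bool" where
  "smooth_plane_field_on I \<pi> \<longleftrightarrow>
     (\<forall>s\<in>I. subspace (\<pi> s) \<and> dim (\<pi> s) = 2) \<and>
     (\<forall>s\<^sub>0\<in>I. \<exists>U u v. open U \<and> s\<^sub>0 \<in> U \<and>
        smooth_curve_on (I \<inter> U) u \<and> smooth_curve_on (I \<inter> U) v \<and>
        (\<forall>s\<in>I \<inter> U. \<pi> s = span {u s, v s}))"

definition xi_2 :: "real set \<Rightarrow> (real \<Rightarrow> real^3) \<Rightarrow> real \<Rightarrow> real^3" where
  "xi_2 I \<xi> s = deriv_on I \<xi> s /\<^sub>R norm (deriv_on I \<xi> s)"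

definition xi_3 :: "real set \<Rightarrow> (real \<Rightarrow> real^3) \<Rightarrow> real \<Rightarrow> real^3" where
  "xi_3 I \<xi> s = \<xi> s \<times> xi_2 I \<xi> s"

definition K_1 :: "real set \<Rightarrow> (real \<Rightarrow> real^3) \<Rightarrow> real \<Rightarrow> real" where
  "K_1 I \<xi> s = norm (deriv_on I \<xi> s)"

text \<open>
  The torsion is the coefficient of the third frame vector in the derivative of the second;
  see the lemma \<open>frenet_equations\<close> below.
\<close>

definition K_2 :: "real set \<Rightarrow> (real \<Rightarrow> real^3) \<Rightarrow> real \<Rightarrow> real" where
  "K_2 I \<xi> s = deriv_on I (xi_2 I \<xi>) s \<bullet> xi_3 I \<xi> s"

locale myller_configuration =
  fixes I :: "real set"
    and r :: "real \<Rightarrow> real^3"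
    and \<xi> :: "real \<Rightarrow> real^3"
    and \<pi> :: "real \<Rightarrow> (real^3) set"
  assumes interval: "is_interval I" "interior I \<noteq> {}"
    and smooth_r: "smooth_curve_on I r"
    and arclength: "\<And>s. s \<in> I \<Longrightarrow> norm (deriv_on I r s) = 1"
    and smooth_xi: "smooth_curve_on I \<xi>"
    and norm_xi: "\<And>s. s \<in> I \<Longrightarrow> norm (\<xi> s) = 1"
    and smooth_plane: "smooth_plane_field_on I \<pi>"
    and xi_in_plane: "\<And>s. s \<in> I \<Longrightarrow> \<xi> s \<in> \<pi> s"
    and K_1_pos: "\<And>s. s \<in> I \<Longrightarrow> K_1 I \<xi> s > 0"

definition slant_helix :: "real set \<Rightarrow> (real \<Rightarrow> real^3) \<Rightarrow> real^3 \<Rightarrow> real \<Rightarrow> bool" where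
  "slant_helix I \<xi> d \<theta> \<longleftrightarrow> norm d = 1 \<and> (\<forall>s\<in>I. xi_2 I \<xi> s \<bullet> d = cos \<theta>)"

lemma orthonormal_expand:
  fixes a b v :: "real^3"
  assumes "norm a = 1" "norm b = 1" "a \<bullet> b = 0"
  shows "v = (v \<bullet> a) *\<^sub>R a + (v \<bullet> b) *\<^sub>R b + (v \<bullet> (a \<times> b)) *\<^sub>R (a \<times> b)"
proof -
  have ab: "a \<bullet> a = 1" "b \<bullet> b = 1" "b \<bullet> a = 0"
    using assms by (auto simp: dot_square_norm inner_commute)
  have "(norm (a \<times> b))\<^sup>2 = 1"
    using norm_cross_dot[of a b] assms by simp
  then have c1: "(a \<times> b) \<bullet> (a \<times> b) = 1"
    by (simp add: dot_square_norm)
  define w where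
    "w = v - ((v \<bullet> a) *\<^sub>R a + (v \<bullet> b) *\<^sub>R b + (v \<bullet> (a \<times> b)) *\<^sub>R (a \<times> b))"
  have wa: "w \<bullet> a = 0" "w \<bullet> b = 0" "w \<bullet> (a \<times> b) = 0"
    unfolding w_def using ab c1 assms(3)
    by (simp_all add: inner_diff_left inner_add_left dot_cross_self)
  have "w \<times> (a \<times> b) = (w \<bullet> b) *\<^sub>R a - (w \<bullet> a) *\<^sub>R b"
    by (simp add: cross3_simps forall_3)
  then have "w \<times> (a \<times> b) = 0" using wa by simp
  with wa have "w = 0 \<or> a \<times> b = 0"
    using norm_and_cross_eq_0[of w "a \<times> b"] by auto
  with c1 have "w = 0" by auto
  then show ?thesis by (simp add: w_def)
qed

context myller_configuration
begin

lemma at_within_nonbot: "s \<in> I \<Longrightarrow> at s within I \<noteq> bot"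
proof -
  assume s: "s \<in> I"
  obtain x where x: "x \<in> interior I" using interval by auto
  then have "open (interior I)" by simp
  with x obtain e where e: "e > 0" "cball x e \<subseteq> interior I"
    using open_contains_cball by blast
  then have "x \<in> I" "x + e \<in> I" using interior_subset[of I]
    by (auto simp: dist_norm subset_iff)
  then have "\<not> (\<exists>y. I = {y})" using e(1) by (metis add_cancel_left_right less_irrefl singletonD)
  then have "s islimpt I"
    using s connected_imp_perfect[of I s] is_interval_connected[OF interval(1)] by blast
  then show ?thesis by (simp add: trivial_limit_within)
qed

lemma deriv_on_eq:
  "s \<in> I \<Longrightarrow> (f has_vector_derivative D) (at s within I) \<Longrightarrow> deriv_on I f s = D"
  unfolding deriv_on_def by (rule vector_derivative_within[OF at_within_nonbot])

lemma has_deriv_on: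
  "s \<in> I \<Longrightarrow> f differentiable_on I \<Longrightarrow>
    (f has_vector_derivative deriv_on I f s) (at s within I)"
  unfolding deriv_on_def differentiable_on_def
  using vector_derivative_works by blast

lemma xi_deriv: "s \<in> I \<Longrightarrow> (\<xi> has_vector_derivative K_1 I \<xi> s *\<^sub>R xi_2 I \<xi> s) (at s within I)"
proof -
  assume s: "s \<in> I"
  have "\<xi> differentiable_on I"
    using smooth_xi unfolding smooth_curve_on_def by (auto dest: spec[of _ 0])
  moreover have "K_1 I \<xi> s *\<^sub>R xi_2 I \<xi> s = deriv_on I \<xi> s"
    using K_1_pos[OF s] by (simp add: K_1_def xi_2_def)
  ultimately show ?thesis using has_deriv_on[OF s] by simp
qed

lemma xi_2_deriv: "s \<in> I \<Longrightarrow> (xi_2 I \<xi> has_vector_derivative deriv_on I (xi_2 I \<xi>) s) (at s within I)"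
proof -
  assume s: "s \<in> I"
  have "deriv_on I \<xi> differentiable_on I"
    using smooth_xi unfolding smooth_curve_on_def by (auto dest: spec[of _ 1])
  then have d: "deriv_on I \<xi> differentiable (at s within I)"
    using s by (simp add: differentiable_on_def)
  have nz: "deriv_on I \<xi> s \<noteq> 0" using K_1_pos[OF s] by (auto simp: K_1_def)
  have "(\<lambda>t. norm (deriv_on I \<xi> t)) differentiable (at s within I)"
    using differentiable_compose[OF differentiable_norm_at[OF nz] d] .
  then have "(\<lambda>t. inverse (norm (deriv_on I \<xi> t))) differentiable (at s within I)"
    by (rule differentiable_inverse) (use nz in simp)
  then have "(\<lambda>t. deriv_on I \<xi> t /\<^sub>R norm (deriv_on I \<xi> t)) differentiable (at s within I)"
    using d by (rule differentiable_scaleR)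
  then have "xi_2 I \<xi> differentiable (at s within I)"
    by (simp add: xi_2_def[abs_def])
  then show ?thesis
    unfolding deriv_on_def using vector_derivative_works by blast
qed

lemma const_inner_deriv:
  assumes "s \<in> I" "(f has_vector_derivative f') (at s within I)"
    "(g has_vector_derivative g') (at s within I)" "\<And>t. t \<in> I \<Longrightarrow> f t \<bullet> g t = c"
  shows "f s \<bullet> g' + f' \<bullet> g s = 0"
proof -
  have "((\<lambda>t. f t \<bullet> g t) has_vector_derivative f s \<bullet> g' + f' \<bullet> g s) (at s within I)"
    by (rule bounded_bilinear.has_vector_derivative[OF bounded_bilinear_inner assms(2,3)])
  moreover have "((\<lambda>t. f t \<bullet> g t) has_vector_derivative 0) (at s within I)"
    using has_vector_derivative_const[of c]
    by (rule has_vector_derivative_transform[OF assms(1), rotated]) (use assms(4) in simp)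
  ultimately show ?thesis
    using vector_derivative_unique_within[OF at_within_nonbot[OF assms(1)]] by blast
qed

lemma frenet_frame_orthonormal:
  assumes s: "s \<in> I"
  shows "norm (\<xi> s) = 1" "norm (xi_2 I \<xi> s) = 1" "norm (xi_3 I \<xi> s) = 1"
    "\<xi> s \<bullet> xi_2 I \<xi> s = 0" "\<xi> s \<bullet> xi_3 I \<xi> s = 0" "xi_2 I \<xi> s \<bullet> xi_3 I \<xi> s = 0"
proof -
  show 1: "norm (\<xi> s) = 1" by (rule norm_xi[OF s])
  show 2: "norm (xi_2 I \<xi> s) = 1" using K_1_pos[OF s] by (simp add: xi_2_def K_1_def)
  have "\<xi> s \<bullet> (K_1 I \<xi> s *\<^sub>R xi_2 I \<xi> s) + (K_1 I \<xi> s *\<^sub>R xi_2 I \<xi> s) \<bullet> \<xi> s = 0"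
    using const_inner_deriv[OF s xi_deriv[OF s] xi_deriv[OF s], of 1] norm_xi
    by (simp add: dot_square_norm)
  then show 3: "\<xi> s \<bullet> xi_2 I \<xi> s = 0" using K_1_pos[OF s] by (simp add: inner_commute)
  show "norm (xi_3 I \<xi> s) = 1"
    using norm_cross_dot[of "\<xi> s" "xi_2 I \<xi> s"] 1 2 3
    by (simp add: xi_3_def power2_eq_1_iff) (metis norm_ge_zero not_one_le_zero neg_0_le_iff_le)
  show "\<xi> s \<bullet> xi_3 I \<xi> s = 0" "xi_2 I \<xi> s \<bullet> xi_3 I \<xi> s = 0"
    by (simp_all add: xi_3_def dot_cross_self)
qed

lemma frenet_equations:
  assumes s: "s \<in> I"
  shows "deriv_on I \<xi> s = K_1 I \<xi> s *\<^sub>R xi_2 I \<xi> s"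
    and "deriv_on I (xi_2 I \<xi>) s = - K_1 I \<xi> s *\<^sub>R \<xi> s + K_2 I \<xi> s *\<^sub>R xi_3 I \<xi> s"
    and "deriv_on I (xi_3 I \<xi>) s = - K_2 I \<xi> s *\<^sub>R xi_2 I \<xi> s"
proof -
  show "deriv_on I \<xi> s = K_1 I \<xi> s *\<^sub>R xi_2 I \<xi> s"
    by (rule deriv_on_eq[OF s xi_deriv[OF s]])
  note o = frenet_frame_orthonormal
  let ?D = "deriv_on I (xi_2 I \<xi>) s"
  have "\<xi> s \<bullet> ?D + (K_1 I \<xi> s *\<^sub>R xi_2 I \<xi> s) \<bullet> xi_2 I \<xi> s = 0"
    by (rule const_inner_deriv[OF s xi_deriv[OF s] xi_2_deriv[OF s] o(4)])
  then have 1: "?D \<bullet> \<xi> s = - K_1 I \<xi> s"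
    using o(2)[OF s] by (simp add: inner_commute dot_square_norm)
  have "xi_2 I \<xi> s \<bullet> ?D + ?D \<bullet> xi_2 I \<xi> s = 0"
    using const_inner_deriv[OF s xi_2_deriv[OF s] xi_2_deriv[OF s], of 1] o(2)
    by (simp add: dot_square_norm)
  then have 2: "?D \<bullet> xi_2 I \<xi> s = 0" by (simp add: inner_commute)
  show D: "?D = - K_1 I \<xi> s *\<^sub>R \<xi> s + K_2 I \<xi> s *\<^sub>R xi_3 I \<xi> s"
    using orthonormal_expand[OF o(1)[OF s] o(2)[OF s] o(4)[OF s], of ?D] 1 2
    by (simp add: K_2_def xi_3_def)
  have bb: "bounded_bilinear (\<times>)"
    using bilinear_cross bilinear_conv_bounded_bilinear by blast
  have "xi_3 I \<xi> = (\<lambda>t. \<xi> t \<times> xi_2 I \<xi> t)" by (simp add: fun_eq_iff xi_3_def)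
  then have "(xi_3 I \<xi> has_vector_derivative
      \<xi> s \<times> ?D + (K_1 I \<xi> s *\<^sub>R xi_2 I \<xi> s) \<times> xi_2 I \<xi> s) (at s within I)"
    using bounded_bilinear.has_vector_derivative[OF bb xi_deriv[OF s] xi_2_deriv[OF s]] by simp
  moreover have "\<xi> s \<times> xi_3 I \<xi> s = - xi_2 I \<xi> s"
  proof -
    have "\<xi> s \<times> xi_3 I \<xi> s
        = (\<xi> s \<bullet> xi_2 I \<xi> s) *\<^sub>R \<xi> s - (\<xi> s \<bullet> \<xi> s) *\<^sub>R xi_2 I \<xi> s"
      by (simp add: xi_3_def cross3_simps forall_3)
    then show ?thesis using o(1,4)[OF s] by (simp add: dot_square_norm)
  qed
  ultimately show "deriv_on I (xi_3 I \<xi>) s = - K_2 I \<xi> s *\<^sub>R xi_2 I \<xi> s"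
    by (intro deriv_on_eq[OF s])
       (simp add: D Cross3.right_diff_distrib cross_mult_right cross_mult_left)
qed

end

end

theory Submission
  imports Defs
begin

text \<open>
  Write \<open>a = \<xi> \<bullet> d\<close> and \<open>c = xi_3 \<bullet> d\<close>. Differentiating \<open>xi_2 \<bullet> d = cos \<theta>\<close> and using the second
  Frenet equation gives \<open>K_1 a = K_2 c\<close>, so \<open>(a, c)\<close> is a multiple of \<open>(K_2, K_1)\<close>. Since \<open>d\<close> is a
  unit vector, Pythagoras in the Frenet frame gives \<open>a\<^sup>2 + c\<^sup>2 = sin\<^sup>2 \<theta>\<close>. These two facts determine
  \<open>(a, c)\<close> at each parameter up to a common sign, which is the sign of \<open>c\<close> because \<open>K_1 > 0\<close>.

  The sign could a priori depend on the parameter. If \<open>sin \<theta> \<noteq> 0\<close>, then \<open>c\<close> has no zeros, because a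
  zero of \<open>c\<close> would also be a zero of \<open>a\<close>. As \<open>c\<close> is continuous and the parameter set is connected,
  its sign is constant. If \<open>sin \<theta> = 0\<close>, both coefficients vanish and either sign will do.
\<close>

lemma nonvanishing_constant_sign:
  fixes f :: "'a::topological_space \<Rightarrow> real"
  assumes "connected S" "continuous_on S f" "\<And>x. x \<in> S \<Longrightarrow> f x \<noteq> 0"
  shows "\<exists>\<epsilon>\<in>{-1, 1}. \<forall>x\<in>S. \<epsilon> * f x > 0"
proof -
  have "connected (f ` S)"
    by (rule connected_continuous_image[OF assms(2,1)])
  then have "\<not> (f x < 0 \<and> 0 < f y)" if "x \<in> S" "y \<in> S" for x y
    using connectedD_interval[of "f ` S" "f x" "f y" 0] that assms(3) by force
  then have "(\<forall>x\<in>S. f x < 0) \<or> (\<forall>x\<in>S. f x > 0)"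
    using assms(3) by (meson linorder_neqE_linordered_idom)
  then show ?thesis by auto
qed

text \<open>
  A vector \<open>(a, c)\<close> of length \<open>\<bar>m\<bar>\<close> in the direction of \<open>(k2, k1)\<close> is the unit vector in that
  direction times \<open>\<plusminus>m\<close>. The hypothesis \<open>\<epsilon> * c \<ge> 0\<close> makes the sign depend only on \<open>\<epsilon>\<close> and \<open>m\<close>, and
  not on \<open>k1\<close> and \<open>k2\<close>, which vary along the curve.
\<close>

lemma proportional_with_given_length:
  fixes a c k1 k2 m \<epsilon> :: real
  assumes k1: "k1 > 0" and rel: "k1 * a = k2 * c" and len: "a\<^sup>2 + c\<^sup>2 = m\<^sup>2"
    and \<epsilon>: "\<epsilon> \<in> {-1, 1}" and sign: "\<epsilon> * c \<ge> 0"
  defines "\<sigma> \<equiv> if m \<ge> 0 then \<epsilon> else - \<epsilon>"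
  shows "a = \<sigma> * m * (k2 / sqrt (k1\<^sup>2 + k2\<^sup>2))"
    and "c = \<sigma> * m * (k1 / sqrt (k1\<^sup>2 + k2\<^sup>2))"
proof -
  let ?\<rho> = "sqrt (k1\<^sup>2 + k2\<^sup>2)"
  have \<rho>: "?\<rho> > 0" "?\<rho>\<^sup>2 = k1\<^sup>2 + k2\<^sup>2"
    using k1 by (simp_all add: add_pos_nonneg)
  have \<sigma>m: "\<sigma> * m = \<epsilon> * \<bar>m\<bar>" by (simp add: \<sigma>_def)
  have "(?\<rho> * (\<epsilon> * c))\<^sup>2 = (k1 * c)\<^sup>2 + (k2 * c)\<^sup>2"
    using \<epsilon> \<rho>(2) by (auto simp: power_mult_distrib algebra_simps)
  also have "\<dots> = (k1 * \<bar>m\<bar>)\<^sup>2"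
    unfolding rel[symmetric] power_mult_distrib power2_abs len[symmetric]
    by (simp add: algebra_simps)
  finally have "?\<rho> * (\<epsilon> * c) = k1 * \<bar>m\<bar>"
    by (rule power2_eq_imp_eq) (use k1 \<rho>(1) sign in simp_all)
  then have "?\<rho> * c = \<sigma> * m * k1"
    unfolding \<sigma>m using \<epsilon> by (auto simp: mult.commute)
  then show c: "c = \<sigma> * m * (k1 / ?\<rho>)"
    using k1 by (simp add: eq_divide_eq mult.commute)
  have "k1 * a = k1 * (\<sigma> * m * (k2 / ?\<rho>))"
    unfolding rel by (subst c) simp
  with k1 show "a = \<sigma> * m * (k2 / ?\<rho>)"
    by (metis mult_left_cancel less_irrefl)
qed

context myller_configuration
begin

lemma continuous_on_xi_3: "continuous_on I (xi_3 I \<xi>)"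
proof -
  have "continuous_on I \<xi>" "continuous_on I (xi_2 I \<xi>)"
    using xi_deriv xi_2_deriv
    by (auto simp: continuous_on_eq_continuous_within intro!: has_vector_derivative_continuous)
  then have "continuous_on I (\<lambda>s. \<xi> s \<times> xi_2 I \<xi> s)"
    by (rule continuous_on_cross)
  then show ?thesis by (simp add: xi_3_def[abs_def])
qed

lemma frenet_frame_expand:
  assumes "s \<in> I"
  shows "v = (v \<bullet> \<xi> s) *\<^sub>R \<xi> s + (v \<bullet> xi_2 I \<xi> s) *\<^sub>R xi_2 I \<xi> s + (v \<bullet> xi_3 I \<xi> s) *\<^sub>R xi_3 I \<xi> s"
  using orthonormal_expand[OF frenet_frame_orthonormal(1,2,4)[OF assms], of v]
  by (simp add: xi_3_def)

lemma slant_helix_axis_relation: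
  assumes s: "s \<in> I" and h: "slant_helix I \<xi> d \<theta>"
  shows "K_1 I \<xi> s * (d \<bullet> \<xi> s) = K_2 I \<xi> s * (d \<bullet> xi_3 I \<xi> s)"
proof -
  have "xi_2 I \<xi> s \<bullet> 0 + deriv_on I (xi_2 I \<xi>) s \<bullet> d = 0"
    by (rule const_inner_deriv[OF s xi_2_deriv[OF s] has_vector_derivative_const])
      (use h in \<open>simp add: slant_helix_def\<close>)
  then have "- K_1 I \<xi> s * (\<xi> s \<bullet> d) + K_2 I \<xi> s * (xi_3 I \<xi> s \<bullet> d) = 0"
    unfolding frenet_equations(2)[OF s] by (simp only: inner_add_left inner_scaleR_left) simp
  then show ?thesis by (simp add: inner_commute[of d])
qed

lemma slant_helix_axis_length:
  assumes s: "s \<in> I" and h: "slant_helix I \<xi> d \<theta>"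
  shows "(d \<bullet> \<xi> s)\<^sup>2 + (d \<bullet> xi_3 I \<xi> s)\<^sup>2 = (sin \<theta>)\<^sup>2"
proof -
  have "d \<bullet> d = d \<bullet> ((d \<bullet> \<xi> s) *\<^sub>R \<xi> s + (d \<bullet> xi_2 I \<xi> s) *\<^sub>R xi_2 I \<xi> s
      + (d \<bullet> xi_3 I \<xi> s) *\<^sub>R xi_3 I \<xi> s)"
    using frenet_frame_expand[OF s, of d] by simp
  also have "\<dots> = (d \<bullet> \<xi> s)\<^sup>2 + (d \<bullet> xi_2 I \<xi> s)\<^sup>2 + (d \<bullet> xi_3 I \<xi> s)\<^sup>2"
    by (simp add: inner_add_right power2_eq_square)
  finally have "1 = (d \<bullet> \<xi> s)\<^sup>2 + (cos \<theta>)\<^sup>2 + (d \<bullet> xi_3 I \<xi> s)\<^sup>2"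
    using h s by (simp add: slant_helix_def dot_square_norm inner_commute)
  then show ?thesis using sin_cos_squared_add[of \<theta>] by linarith
qed

text \<open>
  The inequality is weak so that the case \<open>sin \<theta> = 0\<close>, in which the component vanishes
  identically, is covered as well.
\<close>

lemma slant_helix_axis_constant_sign:
  assumes h: "slant_helix I \<xi> d \<theta>"
  shows "\<exists>\<epsilon>\<in>{-1, 1::real}. \<forall>s\<in>I. \<epsilon> * (d \<bullet> xi_3 I \<xi> s) \<ge> 0"
proof (cases "sin \<theta> = 0")
  case True
  then have "\<forall>s\<in>I. d \<bullet> xi_3 I \<xi> s = 0"
    using slant_helix_axis_length[OF _ h] by (simp add: sum_power2_eq_zero_iff)
  then show ?thesis by auto
next
  case False
  have "d \<bullet> xi_3 I \<xi> s \<noteq> 0" if s: "s \<in> I" for s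
  proof
    assume c: "d \<bullet> xi_3 I \<xi> s = 0"
    then have "d \<bullet> \<xi> s = 0"
      using slant_helix_axis_relation[OF s h] K_1_pos[OF s] by simp
    with c False slant_helix_axis_length[OF s h] show False by simp
  qed
  moreover have "continuous_on I (\<lambda>s. d \<bullet> xi_3 I \<xi> s)"
    by (intro continuous_intros continuous_on_xi_3)
  ultimately obtain \<epsilon> :: real
    where "\<epsilon> \<in> {-1, 1}" "\<forall>s\<in>I. \<epsilon> * (d \<bullet> xi_3 I \<xi> s) > 0"
    using nonvanishing_constant_sign[OF is_interval_connected[OF interval(1)],
        of "\<lambda>s. d \<bullet> xi_3 I \<xi> s"] by blast
  then show ?thesis by (intro bexI[of _ \<epsilon>] ballI less_imp_le) auto
qed

end

theorem corollary6:
  fixes I :: "real set"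
    and r \<xi> :: "real \<Rightarrow> real^3"
    and \<pi> :: "real \<Rightarrow> (real^3) set"
    and d :: "real^3"
    and \<theta> :: real
  assumes "myller_configuration I r \<xi> \<pi>"
    and "slant_helix I \<xi> d \<theta>"
  shows "\<exists>\<sigma>\<in>{-1, 1::real}. \<forall>s\<in>I.
    d = (\<sigma> * sin \<theta> * (K_2 I \<xi> s / sqrt ((K_1 I \<xi> s)\<^sup>2 + (K_2 I \<xi> s)\<^sup>2))) *\<^sub>R \<xi> s
      + cos \<theta> *\<^sub>R xi_2 I \<xi> s
      + (\<sigma> * sin \<theta> * (K_1 I \<xi> s / sqrt ((K_1 I \<xi> s)\<^sup>2 + (K_2 I \<xi> s)\<^sup>2))) *\<^sub>R xi_3 I \<xi> s"
proof -
  interpret myller_configuration I r \<xi> \<pi> by (rule assms(1))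
  note h = assms(2)
  obtain \<epsilon> :: real where \<epsilon>: "\<epsilon> \<in> {-1, 1}" "\<And>s. s \<in> I \<Longrightarrow> \<epsilon> * (d \<bullet> xi_3 I \<xi> s) \<ge> 0"
    using slant_helix_axis_constant_sign[OF h] by blast
  define \<sigma> where "\<sigma> = (if sin \<theta> \<ge> 0 then \<epsilon> else - \<epsilon>)"
  have "\<sigma> \<in> {-1, 1}" using \<epsilon>(1) by (auto simp: \<sigma>_def)
  moreover have "d = (\<sigma> * sin \<theta> * (K_2 I \<xi> s / sqrt ((K_1 I \<xi> s)\<^sup>2 + (K_2 I \<xi> s)\<^sup>2))) *\<^sub>R \<xi> s
      + cos \<theta> *\<^sub>R xi_2 I \<xi> s
      + (\<sigma> * sin \<theta> * (K_1 I \<xi> s / sqrt ((K_1 I \<xi> s)\<^sup>2 + (K_2 I \<xi> s)\<^sup>2))) *\<^sub>R xi_3 I \<xi> s"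
    if s: "s \<in> I" for s
  proof -
    note coeffs = proportional_with_given_length[OF K_1_pos[OF s]
        slant_helix_axis_relation[OF s h] slant_helix_axis_length[OF s h] \<epsilon>(1) \<epsilon>(2)[OF s],
        folded \<sigma>_def]
    have "d \<bullet> xi_2 I \<xi> s = cos \<theta>"
      using h s by (simp add: slant_helix_def inner_commute)
    then show ?thesis
      using frenet_frame_expand[OF s, of d] by (simp only: coeffs[symmetric])
  qed
  ultimately show ?thesis by blast
qed

end
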